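(* Let $G$ be a graph on $n$ vertices that has a perfect matching. Then $c_G(\mathfrak m)=n$.
   Context: Let $G$ be a finite simple graph on the vertex set $[n]=\{1,\dots,n\}$, let $K$ be a field, $S=K[x_1,\dots,x_n,y_1,\dots,y_n]$ and $\mathfrak m=(x_1,\dots,x_n,y_1,\dots,y_n)$. The binomial edge ideal of $G$ is $J_G=(x_iy_j-x_jy_i : \{i,j\}\in E(G))\subset S$. For a positive integer $k$ put $\mathfrak m^{[k]}=(x_1^k,\dots,x_n^k,y_1^k,\dots,y_n^k)$, $(\mathfrak m^{[k]},J_G)=\mathfrak m^{[k]}+J_G$, $v_G(k)=\max\{r\in\mathbb N : \mathfrak m^r\not\subseteq(\mathfrak m^{[k]},J_G)\}$, and $c_G(\mathfrak m)=\lim_{k\to\infty} v_G(k)/k$ (the diagonal $F$-threshold of $S/J_G$). *)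

theory Defs
  imports
    Complex_Main
    "HOL-Library.Cardinality"
    "HOL-Library.Poly_Mapping"
    "HOL-Library.Disjoint_Sets"
    "HOL-Algebra.Ideal_Product"
    "HOL-Algebra.Algebraic_Closure_Type"
begin

text \<open>
  The vertex set is a finite type \<open>'n\<close>, standing for \<open>[n]\<close> with \<open>n = CARD('n)\<close>.
  The ring \<open>S = K[x\<^sub>1,\<dots>,x\<^sub>n,y\<^sub>1,\<dots>,y\<^sub>n]\<close> is the type of finitely supported maps from
  monomials (exponent vectors over the \<open>2n\<close> indeterminates \<open>Inl i\<close> for \<open>x\<^sub>i\<close> and \<open>Inr i\<close>
  for \<open>y\<^sub>i\<close>) to coefficients in \<open>K\<close>, with the convolution product of
  \<^theory>\<open>HOL-Library.Poly_Mapping\<close>.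
\<close>

type_synonym ('n, 'k) xypoly = "(('n + 'n) \<Rightarrow>\<^sub>0 nat) \<Rightarrow>\<^sub>0 'k"

definition x_var :: "'n \<Rightarrow> ('n, 'k::field) xypoly" where
  "x_var i = Poly_Mapping.single (Poly_Mapping.single (Inl i) 1) 1"

definition y_var :: "'n \<Rightarrow> ('n, 'k::field) xypoly" where
  "y_var i = Poly_Mapping.single (Poly_Mapping.single (Inr i) 1) 1"

abbreviation xy_ring :: "('n, 'k::field) xypoly ring" where
  "xy_ring \<equiv> ring_of_type_algebra"

definition max_ideal :: "('n, 'k::field) xypoly set" where
  "max_ideal = genideal xy_ring (range x_var \<union> range y_var)"

definition frob_ideal :: "nat \<Rightarrow> ('n, 'k::field) xypoly set" where
  "frob_ideal k = genideal xy_ring (range (\<lambda>i. x_var i ^ k) \<union> range (\<lambda>i. y_var i ^ k))"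

definition simple_graph :: "'n set set \<Rightarrow> bool" where
  "simple_graph E \<longleftrightarrow> (\<forall>e\<in>E. card e = 2)"

definition perfect_matching :: "'n set set \<Rightarrow> 'n set set \<Rightarrow> bool" where
  "perfect_matching E M \<longleftrightarrow> M \<subseteq> E \<and> disjoint M \<and> \<Union>M = UNIV"

definition binomial_edge_ideal :: "'n set set \<Rightarrow> ('n, 'k::field) xypoly set" where
  "binomial_edge_ideal E =
     genideal xy_ring {x_var i * y_var j - x_var j * y_var i | i j. {i, j} \<in> E}"

text \<open>
  Powers of ideals are taken in the semiring \<^const>\<open>ideals_set\<close> of all ideals, so the zeroth
  power is the whole ring. The base field occurs only in the type of the ideals, hence the
  type argument. For \<open>k > 0\<close> the set below is finite and contains \<open>0\<close>, so the maximum is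
  meaningful; for \<open>k = 0\<close> it is empty and the value is irrelevant to the limit.
\<close>

definition v_num :: "'k::field itself \<Rightarrow> 'n set set \<Rightarrow> nat \<Rightarrow> nat" where
  "v_num _ E k =
     Max {r. \<not> (max_ideal :: ('n, 'k) xypoly set) [^]\<^bsub>ideals_set xy_ring\<^esub> r
               \<subseteq> frob_ideal k <+>\<^bsub>xy_ring\<^esub> binomial_edge_ideal E}"

definition F_threshold :: "'k::field itself \<Rightarrow> 'n set set \<Rightarrow> real" where
  "F_threshold K E = lim (\<lambda>k. real (v_num K E k) / real k)"

end

theory Submission
  imports Defs
begin

text \<open>
  For \<open>k > 0\<close> one has \<open>v\<^sub>G(k) = n(k - 1)\<close> exactly.

  The monomial \<open>(x\<^sub>1\<cdots>x\<^sub>n)\<^bsup>k-1\<^esup>\<close> lies outside the monomial ideal generated by all \<open>y\<^sub>i\<close> and all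
  \<open>x\<^sub>i\<^sup>k\<close>, which contains \<open>\<mm>\<^bsup>[k]\<^esup> + J\<^sub>G\<close> for every graph.

  Conversely, a monomial of degree greater than \<open>n(k - 1)\<close> has degree at least \<open>2k - 1\<close> in the
  four variables of some matching edge \<open>{i,j}\<close>. Hence it has degree at least \<open>k\<close> in \<open>x\<^sub>i, y\<^sub>i\<close> or in
  \<open>x\<^sub>j, y\<^sub>j\<close>, and degree at least \<open>k\<close> in \<open>x\<^sub>i, x\<^sub>j\<close> or in \<open>y\<^sub>i, y\<^sub>j\<close>. The exchange
  \<open>x\<^sub>i y\<^sub>j \<equiv> x\<^sub>j y\<^sub>i\<close> preserves these four degrees and turns the monomial into a multiple of the
  \<open>k\<close>-th power of the variable common to the two heavy pairs.
\<close>

section \<open>Ideals in commutative rings given by a type class\<close>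

lemma type_algebra_simps [simp]:
  "carrier ring_of_type_algebra = UNIV"
  "x \<otimes>\<^bsub>ring_of_type_algebra\<^esub> y = x * y"
  "x \<oplus>\<^bsub>ring_of_type_algebra\<^esub> y = x + y"
  "\<zero>\<^bsub>ring_of_type_algebra\<^esub> = 0"
  "\<one>\<^bsub>ring_of_type_algebra\<^esub> = 1"
  by (simp_all add: ring_of_type_algebra_def)

text \<open>Additive inverses come for free, since -x = (-1) * x, and commutativity makes one-sided
  absorption enough.\<close>

lemma ideal_type_algebra_iff:
  fixes I :: "'a::comm_ring_1 set"
  shows "ideal I ring_of_type_algebra \<longleftrightarrow>
    0 \<in> I \<and> (\<forall>x\<in>I. \<forall>y\<in>I. x + y \<in> I) \<and> (\<forall>x\<in>I. \<forall>a. a * x \<in> I)" (is "?L \<longleftrightarrow> ?R")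
proof
  assume ?L
  then interpret ideal I ring_of_type_algebra .
  show ?R
    using additive_subgroup.zero_closed[OF is_additive_subgroup]
      additive_subgroup.a_closed[OF is_additive_subgroup] I_l_closed by simp
next
  assume R: ?R
  interpret ring "ring_of_type_algebra :: 'a ring"
    by (rule ring_from_type_algebra)
  have inv: "inv\<^bsub>add_monoid ring_of_type_algebra\<^esub> x = - x" for x :: 'a
    unfolding a_inv_def[symmetric] by (rule minus_equality) auto
  show ?L
  proof (rule idealI)
    have "- x \<in> I" if "x \<in> I" for x
      using R that by (metis mult_minus1)
    then show "subgroup I (add_monoid ring_of_type_algebra)"
      using R unfolding subgroup_def inv by auto
  qed (use R ring_axioms in \<open>auto simp: mult.commute\<close>)
qed

lemma
  fixes I :: "'a::comm_ring_1 set"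
  assumes "ideal I ring_of_type_algebra"
  shows type_ideal_zero: "0 \<in> I"
    and type_ideal_add: "x \<in> I \<Longrightarrow> y \<in> I \<Longrightarrow> x + y \<in> I"
    and type_ideal_mult_left: "x \<in> I \<Longrightarrow> a * x \<in> I"
    and type_ideal_mult_right: "x \<in> I \<Longrightarrow> x * a \<in> I"
  using assms by (auto simp: ideal_type_algebra_iff mult.commute)

lemma type_ideal_sum:
  fixes I :: "'a::comm_ring_1 set"
  assumes "ideal I ring_of_type_algebra" "\<And>a. a \<in> A \<Longrightarrow> f a \<in> I"
  shows "sum f A \<in> I"
  using assms(2)
  by (induction A rule: infinite_finite_induct)
     (auto intro: type_ideal_zero[OF assms(1)] type_ideal_add[OF assms(1)])

lemma
  fixes A I :: "'a::comm_ring_1 set"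
  shows type_genideal_ideal: "ideal (genideal ring_of_type_algebra A) ring_of_type_algebra"
    and type_genideal_self: "a \<in> A \<Longrightarrow> a \<in> genideal ring_of_type_algebra A"
    and type_genideal_minimal:
      "ideal I ring_of_type_algebra \<Longrightarrow> A \<subseteq> I \<Longrightarrow> genideal ring_of_type_algebra A \<subseteq> I"
proof -
  interpret ring "ring_of_type_algebra :: 'a ring"
    by (rule ring_from_type_algebra)
  show "ideal (genideal ring_of_type_algebra A) ring_of_type_algebra"
    by (rule genideal_ideal) simp
  show "a \<in> A \<Longrightarrow> a \<in> genideal ring_of_type_algebra A"
    using genideal_self[of A] by auto
  show "ideal I ring_of_type_algebra \<Longrightarrow> A \<subseteq> I \<Longrightarrow> genideal ring_of_type_algebra A \<subseteq> I"
    by (rule genideal_minimal)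
qed

lemma one_ideals_set_type_algebra:
  "\<one>\<^bsub>ideals_set ring_of_type_algebra\<^esub> = (UNIV :: 'a::comm_ring_1 set)"
  by (simp add: ideals_set_def)

lemma type_ideal_pow_Suc:
  fixes I :: "'a::comm_ring_1 set"
  shows "I [^]\<^bsub>ideals_set ring_of_type_algebra\<^esub> Suc r =
    ideal_prod ring_of_type_algebra (I [^]\<^bsub>ideals_set ring_of_type_algebra\<^esub> r) I"
  by (simp add: nat_pow_def ideals_set_def)

lemma type_ideal_pow_mult_power:
  fixes I :: "'a::comm_ring_1 set"
  assumes "q \<in> I [^]\<^bsub>ideals_set ring_of_type_algebra\<^esub> (r::nat)" "p \<in> I"
  shows "q * p ^ s \<in> I [^]\<^bsub>ideals_set ring_of_type_algebra\<^esub> (r + s)"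
proof (induction s)
  case 0
  show ?case using assms(1) by simp
next
  case (Suc s)
  have "(q * p ^ s) \<otimes>\<^bsub>ring_of_type_algebra\<^esub> p \<in> I [^]\<^bsub>ideals_set ring_of_type_algebra\<^esub> Suc (r + s)"
    unfolding type_ideal_pow_Suc by (rule ideal_prod.prod[OF Suc assms(2)])
  then show ?case by (simp add: mult_ac)
qed

text \<open>Supplies, for the lower bound, the membership of the monomial (x_1 ... x_n)^(k-1) in the
  power n(k-1) of \<open>max_ideal\<close>.\<close>

lemma type_ideal_pow_prod_power:
  fixes I :: "'a::comm_ring_1 set"
  assumes "finite A" "\<And>a. a \<in> A \<Longrightarrow> f a \<in> I"
  shows "(\<Prod>a\<in>A. f a ^ s) \<in> I [^]\<^bsub>ideals_set ring_of_type_algebra\<^esub> (card A * s)"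
  using assms
proof (induction A)
  case empty
  show ?case by (simp add: one_ideals_set_type_algebra)
next
  case (insert a A)
  then have "(\<Prod>a\<in>A. f a ^ s) * f a ^ s \<in> I [^]\<^bsub>ideals_set ring_of_type_algebra\<^esub> (card A * s + s)"
    by (intro type_ideal_pow_mult_power) auto
  then show ?case
    using insert.hyps by (simp add: mult.commute add.commute)
qed

text \<open>Modulo \<open>I\<close> the product \<open>w * z\<close> may be replaced by
  \<open>u * v\<close>. This raises the exponents of \<open>u\<close> and \<open>v\<close> by one
  and lowers those of \<open>w\<close> and \<open>z\<close> by one, so \<open>a + b\<close> and
  \<open>a + c\<close> stay fixed. Repeating it \<open>k - a\<close> times produces the factor
  \<open>u ^ k\<close>.\<close>

lemma exchange_in_ideal:
  fixes I :: "'a::comm_ring_1 set"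
  assumes I: "ideal I ring_of_type_algebra"
    and ex: "u * v - w * z \<in> I" and pow: "u ^ k \<in> I"
    and "a + c \<ge> k" "a + b \<ge> k"
  shows "u ^ a * w ^ b * z ^ c * v ^ d \<in> I"
  using assms(4,5)
proof (induction "k - a" arbitrary: a b c d)
  case 0
  then have "u ^ a = u ^ k * u ^ (a - k)"
    by (simp flip: power_add)
  then have "u ^ a \<in> I"
    using type_ideal_mult_right[OF I pow] by simp
  then show ?case
    by (intro type_ideal_mult_right[OF I])
next
  case (Suc m)
  \<comment> \<open>Here a < k, so the two degree bounds force b and c to be positive and an
    exchange is possible.\<close>
  then obtain b' c' where [simp]: "b = Suc b'" "c = Suc c'"
    by (cases b; cases c) auto
  have "u ^ Suc a * w ^ b' * z ^ c' * v ^ Suc d \<in> I"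
    using Suc by (intro Suc(1)) auto
  moreover have "(- (u ^ a * w ^ b' * z ^ c' * v ^ d)) * (u * v - w * z) \<in> I"
    by (rule type_ideal_mult_left[OF I ex])
  ultimately have "u ^ Suc a * w ^ b' * z ^ c' * v ^ Suc d
      + (- (u ^ a * w ^ b' * z ^ c' * v ^ d)) * (u * v - w * z) \<in> I"
    by (rule type_ideal_add[OF I])
  then show ?case
    by (simp add: algebra_simps)
qed

section \<open>Monomials and monomial ideals\<close>

text \<open>Every exponent of a product is a sum of exponents of the factors. The lemma yields both
  the degree filtration and the monomial ideal that separates off the lower-bound monomial.\<close>

lemma ideal_keys_subset:
  assumes "\<And>u v. u \<in> U \<Longrightarrow> v + u \<in> U"
  shows "ideal {p :: 'a::comm_monoid_add \<Rightarrow>\<^sub>0 'k::comm_ring_1. Poly_Mapping.keys p \<subseteq> U}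
    ring_of_type_algebra"
  unfolding ideal_type_algebra_iff
proof (intro conjI ballI allI; clarsimp)
  fix p q :: "'a \<Rightarrow>\<^sub>0 'k" and u
  assume "Poly_Mapping.keys p \<subseteq> U" "Poly_Mapping.keys q \<subseteq> U" "u \<in> Poly_Mapping.keys (p + q)"
  then show "u \<in> U" using keys_add[of p q] by blast
next
  fix p a :: "'a \<Rightarrow>\<^sub>0 'k" and u
  assume "Poly_Mapping.keys p \<subseteq> U" "u \<in> Poly_Mapping.keys (a * p)"
  then show "u \<in> U" using keys_mult[of a p] assms by blast
qed

lemma poly_mapping_sum_keys:
  fixes p :: "'a \<Rightarrow>\<^sub>0 'k::comm_monoid_add"
  shows "(\<Sum>u\<in>Poly_Mapping.keys p. Poly_Mapping.single u (Poly_Mapping.lookup p u)) = p"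
  by (rule poly_mapping_eqI)
     (auto simp: lookup_sum lookup_single when_def in_keys_iff)

lemma in_ideal_if_monomials:
  fixes p :: "'a::comm_monoid_add \<Rightarrow>\<^sub>0 'k::comm_ring_1"
  assumes I: "ideal I ring_of_type_algebra"
    and mono: "\<And>u. u \<in> Poly_Mapping.keys p \<Longrightarrow> Poly_Mapping.single u 1 \<in> I"
  shows "p \<in> I"
proof -
  have "Poly_Mapping.single u (Poly_Mapping.lookup p u) \<in> I" if "u \<in> Poly_Mapping.keys p" for u
    \<comment> \<open>The coefficient acts as multiplication by a constant polynomial.\<close>
    using type_ideal_mult_left[OF I mono[OF that], of "Poly_Mapping.single 0 (Poly_Mapping.lookup p u)"]
    by (simp add: mult_single)
  then have "(\<Sum>u\<in>Poly_Mapping.keys p. Poly_Mapping.single u (Poly_Mapping.lookup p u)) \<in> I"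
    by (intro type_ideal_sum[OF I])
  then show ?thesis by (simp add: poly_mapping_sum_keys)
qed

lemma single_power:
  "Poly_Mapping.single (Poly_Mapping.single v (Suc 0)) (1::'k::comm_semiring_1) ^ e =
   Poly_Mapping.single (Poly_Mapping.single v e) 1"
  by (induction e) (simp_all add: mult_single flip: single_add)

lemma prod_single:
  "finite A \<Longrightarrow> (\<Prod>a\<in>A. Poly_Mapping.single (f a) (1::'k::comm_semiring_1)) =
    Poly_Mapping.single (\<Sum>a\<in>A. f a) 1"
  by (induction A rule: finite_induct) (simp_all add: mult_single)

lemma monomial_eq_prod:
  fixes u :: "'v::finite \<Rightarrow>\<^sub>0 nat"
  shows "Poly_Mapping.single u (1::'k::comm_semiring_1) =
    (\<Prod>v\<in>UNIV. Poly_Mapping.single (Poly_Mapping.single v 1) 1 ^ Poly_Mapping.lookup u v)"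
proof -
  have "(\<Sum>v\<in>UNIV. Poly_Mapping.single v (Poly_Mapping.lookup u v)) = u"
    by (rule poly_mapping_eqI) (simp add: lookup_sum lookup_single when_def)
  then show ?thesis by (simp add: single_power prod_single)
qed

definition total_degree :: "('v::finite \<Rightarrow>\<^sub>0 nat) \<Rightarrow> nat" where
  "total_degree u = (\<Sum>v\<in>UNIV. Poly_Mapping.lookup u v)"

lemma total_degree_add: "total_degree (u + v) = total_degree u + total_degree v"
  by (simp add: total_degree_def lookup_add sum.distrib)

lemma total_degree_single: "total_degree (Poly_Mapping.single v e) = e"
  by (simp add: total_degree_def lookup_single when_def)

section \<open>The ideals attached to a graph\<close>

lemma ideal_frob_ideal: "ideal (frob_ideal k) ring_of_type_algebra"
  and ideal_binomial_edge_ideal: "ideal (binomial_edge_ideal E) ring_of_type_algebra"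
  by (simp_all add: frob_ideal_def binomial_edge_ideal_def type_genideal_ideal)

lemma mem_max_ideal: "x_var i \<in> max_ideal"
  by (auto simp: max_ideal_def intro!: type_genideal_self)

lemma
  fixes E :: "'n set set" and k :: nat
  defines "(I :: ('n, 'k::field) xypoly set) \<equiv>
    frob_ideal k <+>\<^bsub>xy_ring\<^esub> binomial_edge_ideal E"
  shows ideal_frob_plus_edge: "ideal I ring_of_type_algebra"
    and x_power_in_frob_plus_edge: "x_var i ^ k \<in> I"
    and y_power_in_frob_plus_edge: "y_var i ^ k \<in> I"
    and edge_binomial_in_frob_plus_edge:
      "{i, j} \<in> E \<Longrightarrow> x_var i * y_var j - x_var j * y_var i \<in> I"
proof -
  interpret ring "xy_ring :: ('n, 'k) xypoly ring"
    by (rule ring_from_type_algebra)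
  show "ideal I ring_of_type_algebra"
    unfolding I_def by (rule add_ideals[OF ideal_frob_ideal ideal_binomial_edge_ideal])
  have frob: "p \<in> I" if "p \<in> frob_ideal k" for p
    using that type_ideal_zero[OF ideal_binomial_edge_ideal, of E]
    by (force simp: I_def set_add_def')
  have edge: "p \<in> I" if "p \<in> binomial_edge_ideal E" for p
    using that type_ideal_zero[OF ideal_frob_ideal, of k]
    by (force simp: I_def set_add_def')
  show "x_var i ^ k \<in> I" "y_var i ^ k \<in> I"
    by (auto simp: frob_ideal_def intro!: frob type_genideal_self)
  show "x_var i * y_var j - x_var j * y_var i \<in> I" if "{i, j} \<in> E"
    by (intro edge, unfold binomial_edge_ideal_def, rule type_genideal_self) (use that in blast)
qed

section \<open>Upper bound: high powers of the maximal ideal\<close>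

text \<open>Each factor from \<open>max_ideal\<close> contributes degree at least 1, and degrees add
  under multiplication. This reduces the upper bound to single monomials.\<close>

lemma max_ideal_pow_subset_degree:
  "(max_ideal :: ('n::finite, 'k::field) xypoly set) [^]\<^bsub>ideals_set xy_ring\<^esub> r \<subseteq>
    {p. Poly_Mapping.keys p \<subseteq> {u. r \<le> total_degree u}}"
proof (induction r)
  case 0
  show ?case by simp
next
  case (Suc r)
  have ideg: "ideal {p :: ('n, 'k) xypoly. Poly_Mapping.keys p \<subseteq> {u. d \<le> total_degree u}}
      ring_of_type_algebra" for d
    by (rule ideal_keys_subset) (simp add: total_degree_add)
  have max: "(max_ideal :: ('n, 'k) xypoly set) \<subseteq>
      {p. Poly_Mapping.keys p \<subseteq> {u. 1 \<le> total_degree u}}"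
    unfolding max_ideal_def
    by (rule type_genideal_minimal[OF ideg]) (auto simp: x_var_def y_var_def total_degree_single)
  show ?case
  proof
    fix p :: "('n, 'k) xypoly"
    assume "p \<in> max_ideal [^]\<^bsub>ideals_set xy_ring\<^esub> Suc r"
    then show "p \<in> {p. Poly_Mapping.keys p \<subseteq> {u. Suc r \<le> total_degree u}}"
      unfolding type_ideal_pow_Suc
    proof (induction rule: ideal_prod.induct)
      case (prod f g)
      have "Suc r \<le> total_degree (a + b)"
        if "a \<in> Poly_Mapping.keys f" "b \<in> Poly_Mapping.keys g" for a b
      proof -
        have "r \<le> total_degree a" "1 \<le> total_degree b"
          using that prod Suc max by blast+
        then show ?thesis by (simp add: total_degree_add)
      qed
      then show ?case using keys_mult[of f g] by fastforce
    next
      case (sum f g)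
      then show ?case using type_ideal_add[OF ideg] by simp
    qed
  qed
qed

lemma edge_monomial_in_ideal:
  fixes u :: "('n::finite + 'n) \<Rightarrow>\<^sub>0 nat" and i j :: 'n
  defines "a \<equiv> Poly_Mapping.lookup u (Inl i)" and "b \<equiv> Poly_Mapping.lookup u (Inl j)"
    and "c \<equiv> Poly_Mapping.lookup u (Inr i)" and "d \<equiv> Poly_Mapping.lookup u (Inr j)"
  assumes "{i, j} \<in> E" "i \<noteq> j" "2 * k \<le> Suc (a + b + c + d)"
  shows "Poly_Mapping.single u (1 :: 'k::field) \<in> frob_ideal k <+>\<^bsub>xy_ring\<^esub> binomial_edge_ideal E"
proof -
  define I :: "('n, 'k) xypoly set" where "I = frob_ideal k <+>\<^bsub>xy_ring\<^esub> binomial_edge_ideal E"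
  note I = ideal_frob_plus_edge[of k E, where ?'k = 'k, folded I_def]
  note xp = x_power_in_frob_plus_edge[of _ k E, where ?'k = 'k, folded I_def]
  note yp = y_power_in_frob_plus_edge[of _ k E, where ?'k = 'k, folded I_def]
  note bin = edge_binomial_in_frob_plus_edge[of _ _ E k, where ?'k = 'k, folded I_def]
  let ?V = "{Inl i, Inl j, Inr i, Inr j}"
  let ?X = "x_var :: 'n \<Rightarrow> ('n, 'k) xypoly" and ?Y = "y_var :: 'n \<Rightarrow> ('n, 'k) xypoly"
  let ?f = "\<lambda>v. Poly_Mapping.single (Poly_Mapping.single v 1) (1::'k) ^ Poly_Mapping.lookup u v"
  have ij: "{i, j} \<in> E" "{j, i} \<in> E"
    using assms(5) by (simp_all add: insert_commute)
  have ex1: "?X i * ?Y j - ?X j * ?Y i \<in> I" and ex2: "?X j * ?Y i - ?X i * ?Y j \<in> I"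
    using bin[OF ij(1)] bin[OF ij(2)] by simp_all
  \<comment> \<open>The same binomials with a y-variable in front, so that it can play the role of
    \<open>u\<close> in \<open>exchange_in_ideal\<close>.\<close>
  have ex3: "?Y i * ?X j - ?Y j * ?X i \<in> I" and ex4: "?Y j * ?X i - ?Y i * ?X j \<in> I"
    using ex1 ex2 by (simp_all add: mult.commute)
  \<comment> \<open>Both (a + c) + (b + d) and (a + b) + (c + d) are at least 2k - 1, so in each sum
    some bracket reaches k. The four cases make x_i, x_j, y_i, y_j, in this order, the variable
    whose power is built up.\<close>
  consider "k \<le> a + c" "k \<le> a + b" | "k \<le> b + d" "k \<le> b + a"
    | "k \<le> c + a" "k \<le> c + d" | "k \<le> d + b" "k \<le> d + c"
    using assms(7) by linarith
  then have "?X i ^ a * ?X j ^ b * ?Y i ^ c * ?Y j ^ d \<in> I"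
  proof cases
    case 1
    then show ?thesis by (rule exchange_in_ideal[OF I ex1 xp])
  next
    case 2
    from exchange_in_ideal[OF I ex2 xp this, of c] show ?thesis by (simp add: mult_ac)
  next
    case 3
    from exchange_in_ideal[OF I ex3 yp this, of b] show ?thesis by (simp add: mult_ac)
  next
    case 4
    from exchange_in_ideal[OF I ex4 yp this, of a] show ?thesis by (simp add: mult_ac)
  qed
  moreover have "(\<Prod>v\<in>?V. ?f v) = ?X i ^ a * ?X j ^ b * ?Y i ^ c * ?Y j ^ d"
    using assms(6) by (simp add: x_var_def y_var_def a_def b_def c_def d_def mult_ac)
  \<comment> \<open>The variables off the edge form a cofactor, which the ideal absorbs.\<close>
  moreover have "Poly_Mapping.single u (1::'k) = (\<Prod>v\<in>UNIV - ?V. ?f v) * (\<Prod>v\<in>?V. ?f v)"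
    unfolding monomial_eq_prod[of u] by (rule prod.subset_diff) auto
  ultimately show ?thesis
    using type_ideal_mult_left[OF I] by (simp add: I_def)
qed

text \<open>Pigeonhole: the matching edges partition the vertices into pairs, so if each had weight
  at most 2(k - 1), the total would be at most n(k - 1).\<close>

lemma matching_heavy_edge:
  fixes E :: "'n::finite set set" and w :: "'n \<Rightarrow> nat"
  assumes "simple_graph E" "perfect_matching E M" "k > 0"
    and "(\<Sum>i\<in>UNIV. w i) > CARD('n) * (k - 1)"
  obtains i j where "{i, j} \<in> E" "i \<noteq> j" "2 * k \<le> Suc (w i + w j)"
proof -
  have M: "\<And>e. e \<in> M \<Longrightarrow> card e = 2" "M \<subseteq> E" "disjoint M" "\<Union>M = UNIV"
    using assms by (auto simp: simple_graph_def perfect_matching_def)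
  have split: "(\<Sum>i\<in>UNIV. f i) = (\<Sum>e\<in>M. \<Sum>i\<in>e. f i)" for f :: "'n \<Rightarrow> nat"
    using sum.Union_disjoint[of M f] M(3,4)
    by (simp add: disjoint_def)
  \<comment> \<open>Weight 1 on every vertex turns the splitting into a count of vertices.\<close>
  have "CARD('n) = (\<Sum>e\<in>M. card e)"
    using split[of "\<lambda>_. 1"] by simp
  then have "(\<Sum>e\<in>M. 2 * (k - 1)) < (\<Sum>e\<in>M. \<Sum>i\<in>e. w i)"
    using assms(4) M(1) by (simp add: split[of w] mult_ac)
  then obtain e where e: "e \<in> M" "2 * (k - 1) < (\<Sum>i\<in>e. w i)"
    by (meson sum_mono not_less)
  obtain i j where "e = {i, j}" "i \<noteq> j"
    using M(1)[OF e(1)] by (auto simp: card_2_iff)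
  then show ?thesis
    using e M(2) by (intro that[of i j]) auto
qed

lemma max_ideal_pow_subset:
  fixes E :: "'n::finite set set"
  assumes "simple_graph E" "perfect_matching E M" "k > 0" "r > CARD('n) * (k - 1)"
  shows "(max_ideal :: ('n, 'k::field) xypoly set) [^]\<^bsub>ideals_set xy_ring\<^esub> r
    \<subseteq> frob_ideal k <+>\<^bsub>xy_ring\<^esub> binomial_edge_ideal E"
proof
  fix p :: "('n, 'k) xypoly"
  assume "p \<in> max_ideal [^]\<^bsub>ideals_set xy_ring\<^esub> r"
  then have deg: "r \<le> total_degree u" if "u \<in> Poly_Mapping.keys p" for u
    using that max_ideal_pow_subset_degree by blast
  show "p \<in> frob_ideal k <+>\<^bsub>xy_ring\<^esub> binomial_edge_ideal E"
  proof (rule in_ideal_if_monomials[OF ideal_frob_plus_edge])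
    fix u assume "u \<in> Poly_Mapping.keys p"
    let ?w = "\<lambda>i. Poly_Mapping.lookup u (Inl i) + Poly_Mapping.lookup u (Inr i)"
    have "total_degree u = (\<Sum>i\<in>UNIV. ?w i)"
      \<comment> \<open>The index type is read as a disjoint union, to split the degree into its x-
        and y-parts.\<close>
      by (simp add: total_degree_def UNIV_Plus_UNIV[symmetric] sum.Plus sum.distrib
               del: UNIV_Plus_UNIV)
    then have "(\<Sum>i\<in>UNIV. ?w i) > CARD('n) * (k - 1)"
      using deg[OF \<open>u \<in> _\<close>] assms(4) by simp
    from matching_heavy_edge[OF assms(1-3) this] obtain i j
      where "{i, j} \<in> E" "i \<noteq> j" "2 * k \<le> Suc (?w i + ?w j)" .
    then show "Poly_Mapping.single u 1 \<in> frob_ideal k <+>\<^bsub>xy_ring\<^esub> binomial_edge_ideal E"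
      by (intro edge_monomial_in_ideal[of i j]) (auto simp: add_ac)
  qed
qed

section \<open>Lower bound: a monomial outside the ideal\<close>

lemma max_ideal_pow_not_subset:
  fixes E :: "'n::finite set set"
  assumes "k > 0"
  shows "\<not> (max_ideal :: ('n, 'k::field) xypoly set) [^]\<^bsub>ideals_set xy_ring\<^esub> (CARD('n) * (k - 1))
    \<subseteq> frob_ideal k <+>\<^bsub>xy_ring\<^esub> binomial_edge_ideal E"
proof
  \<comment> \<open>The exponents of the monomials in the ideal generated by all y_i and all x_i^k;
    \<open>?Q\<close> is that ideal.\<close>
  define U :: "(('n + 'n) \<Rightarrow>\<^sub>0 nat) set" where
    "U = {u. (\<exists>i. Poly_Mapping.lookup u (Inr i) \<ge> 1) \<or> (\<exists>i. Poly_Mapping.lookup u (Inl i) \<ge> k)}"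
  define m :: "('n + 'n) \<Rightarrow>\<^sub>0 nat" where "m = (\<Sum>i\<in>UNIV. Poly_Mapping.single (Inl i) (k - 1))"
  let ?Q = "{p :: ('n, 'k) xypoly. Poly_Mapping.keys p \<subseteq> U}"
  have Q: "ideal ?Q ring_of_type_algebra"
  proof (rule ideal_keys_subset)
    show "v + u \<in> U" if "u \<in> U" for u v
      using that unfolding U_def by (fastforce simp: lookup_add intro: trans_le_add2)
  qed
  have y: "y_var i \<in> ?Q" for i
    by (auto simp: U_def y_var_def lookup_single when_def)
  \<comment> \<open>Positivity of k matters: for k = 0 the power would be 1.\<close>
  have "y_var i ^ k = y_var i ^ (k - 1) * (y_var i :: ('n, 'k) xypoly)" for i
    using assms by (cases k) (simp_all add: mult.commute)
  then have yk: "y_var i ^ k \<in> ?Q" for i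
    using type_ideal_mult_left[OF Q y] by simp
  have xk: "x_var i ^ k \<in> ?Q" for i
    by (auto simp: U_def x_var_def single_power lookup_single when_def)
  have frob: "frob_ideal k \<subseteq> ?Q"
    unfolding frob_ideal_def by (rule type_genideal_minimal[OF Q]) (use xk yk in blast)
  \<comment> \<open>Both terms of the binomial contain a y-variable, so whether i and j are adjacent
    is irrelevant.\<close>
  have "x_var i * y_var j - x_var j * y_var i \<in> ?Q" for i j
    using type_ideal_add[OF Q type_ideal_mult_left[OF Q y, of "x_var i" j]
        type_ideal_mult_left[OF Q y, of "- x_var j" i]] by simp
  then have edge: "binomial_edge_ideal E \<subseteq> ?Q"
    unfolding binomial_edge_ideal_def by (intro type_genideal_minimal[OF Q]) blast
  have sum: "p \<in> ?Q" if "p \<in> frob_ideal k <+>\<^bsub>xy_ring\<^esub> binomial_edge_ideal E" for p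
  proof -
    from that obtain f g where fg: "p = f + g" "f \<in> frob_ideal k" "g \<in> binomial_edge_ideal E"
      by (auto simp: set_add_def')
    then have "f \<in> ?Q" "g \<in> ?Q"
      using frob edge by blast+
    from type_ideal_add[OF Q this] show ?thesis
      by (simp only: fg(1))
  qed
  assume "(max_ideal :: ('n, 'k) xypoly set) [^]\<^bsub>ideals_set xy_ring\<^esub> (CARD('n) * (k - 1))
    \<subseteq> frob_ideal k <+>\<^bsub>xy_ring\<^esub> binomial_edge_ideal E"
  moreover have "(\<Prod>i\<in>UNIV. x_var i ^ (k - 1)) \<in>
      (max_ideal :: ('n, 'k) xypoly set) [^]\<^bsub>ideals_set xy_ring\<^esub> (CARD('n) * (k - 1))"
    by (intro type_ideal_pow_prod_power mem_max_ideal) simp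
  ultimately have "(\<Prod>i\<in>UNIV. x_var i ^ (k - 1)) \<in> ?Q"
    using sum by blast
  moreover have "(\<Prod>i\<in>UNIV. x_var i ^ (k - 1)) = Poly_Mapping.single m (1::'k)"
    by (simp add: x_var_def single_power prod_single m_def)
  ultimately have "m \<in> U" by simp
  \<comment> \<open>All y-exponents of \<open>m\<close> are 0 and all its x-exponents are k - 1 <
    k.\<close>
  then show False
    using assms by (auto simp: U_def m_def lookup_sum lookup_single when_def)
qed

section \<open>Exact value and limit\<close>

lemma v_num_eq:
  fixes E :: "'n::finite set set"
  assumes "simple_graph E" "perfect_matching E M" "k > 0"
  shows "v_num TYPE('k::field) E k = CARD('n) * (k - 1)"
  unfolding v_num_def
proof (rule Max_eqI)
  let ?S = "{r::nat. \<not> (max_ideal :: ('n, 'k) xypoly set) [^]\<^bsub>ideals_set xy_ring\<^esub> r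
               \<subseteq> frob_ideal k <+>\<^bsub>xy_ring\<^esub> binomial_edge_ideal E}"
  \<comment> \<open>The bound also gives the finiteness on which \<open>Max\<close> depends.\<close>
  show le: "r \<le> CARD('n) * (k - 1)" if "r \<in> ?S" for r
    using that max_ideal_pow_subset[OF assms] by (auto simp: not_less[symmetric])
  then show "finite ?S"
    unfolding finite_nat_set_iff_bounded_le by blast
  show "CARD('n) * (k - 1) \<in> ?S"
    using max_ideal_pow_not_subset[OF assms(3)] by blast
qed

theorem proposition3p3:
  fixes E :: "'n::finite set set"
  assumes "simple_graph E"
    and "\<exists>M. perfect_matching E M"
  shows "convergent (\<lambda>k. real (v_num TYPE('k::field) E k) / real k) \<and>
         F_threshold TYPE('k) E = real CARD('n)"
proof -
  obtain M where M: "perfect_matching E M"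
    using assms(2) by blast
  let ?n = "real CARD('n)"
  have "(\<lambda>k. ?n - ?n / real k) \<longlonglongrightarrow> ?n - 0"
    by (intro tendsto_diff tendsto_const lim_const_over_n)
  \<comment> \<open>For k > 0 the quotient n(k - 1)/k equals n - n/k; the index k = 0, where
    \<open>v_num_eq\<close> says nothing, is discarded.\<close>
  moreover have "\<forall>\<^sub>F k in sequentially. ?n - ?n / real k = real (v_num TYPE('k) E k) / real k"
    using eventually_gt_at_top[of "0::nat"]
    by eventually_elim (simp add: v_num_eq[OF assms(1) M] of_nat_diff field_simps)
  ultimately have "(\<lambda>k. real (v_num TYPE('k) E k) / real k) \<longlonglongrightarrow> ?n"
    by (auto dest: Lim_transform_eventually)
  then show ?thesis
    unfolding F_threshold_def by (auto simp: convergent_def dest: limI)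
qed

end
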